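(* A functor $F\colon\mathsf{C}\to\mathsf{D}$ is full and surjective on objects if, and only if, it is an extremal epimorphism and Riguet-full (the latter being equivalent to: the Riguet kernel $\mathrm{K}^{\mathrm{r}}(F)$ is a Riguet congruence on $\mathsf{C}$).
   Context: Extremal epimorphisms are taken in $\mathsf{Cat}$, the category of all $\mathbf{U}$-categories (for a fixed Grothendieck universe $\mathbf{U}$, categories with object set included in $\mathbf{U}$ and hom-sets elements of $\mathbf{U}$) and functors between them. A functor $F\colon\mathsf{C}\to\mathsf{D}$ is Riguet-full if, for all objects $a,a',b,b'$ of $\mathsf{C}$ and every $f\in\mathrm{Hom}_{\mathsf{C}}(a,b)$, if $F(a)=F(a')$ and $F(b)=F(b')$, then there is $f'\in\mathrm{Hom}_{\mathsf{C}}(a',b')$ with $F(f)=F(f')$. The Riguet kernel of $F$ is the pair $\mathrm{K}^{\mathrm{r}}(F)$ with $\mathrm{K}^{\mathrm{r}}(F)^{\mathrm{ob}}=\{(a,a')\mid F(a)=F(a')\}$ and, for $(a,a'),(b,b')\in\mathrm{K}^{\mathrm{r}}(F)^{\mathrm{ob}}$, $\mathrm{K}^{\mathrm{r}}(F)^{\mathrm{fl}}_{\left(\begin{smallmatrix}a&b\\ a'&b'\end{smallmatrix}\right)}=\{(f,f')\in\mathrm{Hom}_{\mathsf{C}}(a,b)\times\mathrm{Hom}_{\mathsf{C}}(a',b')\mid F(f)=F(f')\}$. A Riguet congruence on a category $\mathsf{C}$ is a pair $\Phi=(\Phi^{\mathrm{ob}},\Phi^{\mathrm{fl}})$ where $\Phi^{\mathrm{ob}}$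 is an equivalence relation on $\mathrm{Ob}(\mathsf{C})$ and $\Phi^{\mathrm{fl}}$ assigns to all $(a,a'),(b,b')\in\Phi^{\mathrm{ob}}$ a subset $\Phi^{\mathrm{fl}}_{\left(\begin{smallmatrix}a&b\\ a'&b'\end{smallmatrix}\right)}\subseteq\mathrm{Hom}_{\mathsf{C}}(a,b)\times\mathrm{Hom}_{\mathsf{C}}(a',b')$ such that: (a) if $(a,b)\in\Phi^{\mathrm{ob}}$, then $(\mathrm{id}_a,\mathrm{id}_b)\in\Phi^{\mathrm{fl}}_{\left(\begin{smallmatrix}a&a\\ b&b\end{smallmatrix}\right)}$; (b) if $f\in\mathrm{Hom}_{\mathsf{C}}(a,b)$, then $(f,f)\in\Phi^{\mathrm{fl}}_{\left(\begin{smallmatrix}a&b\\ a&b\end{smallmatrix}\right)}$; (c) if $(f,f')\in\Phi^{\mathrm{fl}}_{\left(\begin{smallmatrix}a&b\\ a'&b'\end{smallmatrix}\right)}$, then $(f',f)\in\Phi^{\mathrm{fl}}_{\left(\begin{smallmatrix}a'&b'\\ a&b\end{smallmatrix}\right)}$; (d) if $(f,f')\in\Phi^{\mathrm{fl}}_{\left(\begin{smallmatrix}a&b\\ a'&b'\end{smallmatrix}\right)}$ and $(f',f'')\in\Phi^{\mathrm{fl}}_{\left(\begin{smallmatrix}a'&b'\\ a''&b''\end{smallmatrix}\right)}$, then $(f,f'')\in\Phi^{\mathrm{fl}}_{\left(\begin{smallmatrix}a&b\\ a''&b''\end{smallmatrix}\right)}$; (e) if $(f,f')\in\Phi^{\mathrm{fl}}_{\left(\begin{smallmatrix}a&b\\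 a'&b'\end{smallmatrix}\right)}$ and $(g,g')\in\Phi^{\mathrm{fl}}_{\left(\begin{smallmatrix}b&c\\ b'&c'\end{smallmatrix}\right)}$, then $(g\circ f,g'\circ f')\in\Phi^{\mathrm{fl}}_{\left(\begin{smallmatrix}a&c\\ a'&c'\end{smallmatrix}\right)}$; (f) for all $(a,a'),(b,b')\in\Phi^{\mathrm{ob}}$ and $f\in\mathrm{Hom}_{\mathsf{C}}(a,b)$ there is $f'\in\mathrm{Hom}_{\mathsf{C}}(a',b')$ with $(f,f')\in\Phi^{\mathrm{fl}}_{\left(\begin{smallmatrix}a&b\\ a'&b'\end{smallmatrix}\right)}$. *)

theory Defs
  imports "HOL-Library.FuncSet"
begin

section \<open>Grothendieck universes\<close>

text \<open>
  A universe \<open>U\<close> is rendered as a type whose members are the members of \<open>U\<close>; \<open>elts x\<close> is the set of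
  elements of \<open>x \<in> U\<close>.  That elements of members of \<open>U\<close> lie again in \<open>U\<close> is thus part of the
  typing, and so is \<open>U \<noteq> {}\<close>.  The first two axioms (extensionality, foundation) say that \<open>elts\<close>
  is, up to isomorphism, a genuine membership relation; the other three are the closure of \<open>U\<close> under
  unordered pairs, full power sets, and unions of families of members indexed by a member.
  As in SGA 4, \<open>\<omega> \<in> U\<close> is not demanded: universes containing \<open>\<omega>\<close> are a special case.
\<close>

class grothendieck_universe =
  fixes elts :: "'a \<Rightarrow> 'a set"
  assumes elts_inject: "elts x = elts y \<Longrightarrow> x = y"
    and elts_foundation: "wf {(x, y). x \<in> elts y}"
    and pair_in_universe: "\<exists>z. elts z = {x, y}"
    and power_in_universe: "\<exists>p. elts ` elts p = Pow (elts x)"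
    and union_in_universe: "\<exists>u. elts u = (\<Union>i\<in>elts x. elts (f i))"


section \<open>Categories and functors\<close>

text \<open>
  Hom-sets are not assumed to be disjoint, so composition and the arrow part of a functor carry the
  objects involved as arguments: \<open>Comp C a b c g f\<close> is the composite of \<open>f \<in> Hom C a b\<close> and
  \<open>g \<in> Hom C b c\<close>.  The values of the fields outside \<open>Ob C\<close> and \<open>Hom C a b\<close> are irrelevant.
\<close>

record ('o, 'm) cat =
  Ob :: "'o set"
  Hom :: "'o \<Rightarrow> 'o \<Rightarrow> 'm set"
  Id :: "'o \<Rightarrow> 'm"
  Comp :: "'o \<Rightarrow> 'o \<Rightarrow> 'o \<Rightarrow> 'm \<Rightarrow> 'm \<Rightarrow> 'm"

locale category =
  fixes C :: "('o, 'm) cat"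
  assumes Id_in_Hom: "a \<in> Ob C \<Longrightarrow> Id C a \<in> Hom C a a"
    and Comp_in_Hom:
      "\<lbrakk>a \<in> Ob C; b \<in> Ob C; c \<in> Ob C; f \<in> Hom C a b; g \<in> Hom C b c\<rbrakk>
        \<Longrightarrow> Comp C a b c g f \<in> Hom C a c"
    and Comp_Id_right:
      "\<lbrakk>a \<in> Ob C; b \<in> Ob C; f \<in> Hom C a b\<rbrakk> \<Longrightarrow> Comp C a a b f (Id C a) = f"
    and Comp_Id_left:
      "\<lbrakk>a \<in> Ob C; b \<in> Ob C; f \<in> Hom C a b\<rbrakk> \<Longrightarrow> Comp C a b b (Id C b) f = f"
    and Comp_assoc:
      "\<lbrakk>a \<in> Ob C; b \<in> Ob C; c \<in> Ob C; d \<in> Ob C;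
        f \<in> Hom C a b; g \<in> Hom C b c; h \<in> Hom C c d\<rbrakk>
        \<Longrightarrow> Comp C a c d h (Comp C a b c g f) = Comp C a b d (Comp C b c d h g) f"

record ('o, 'm, 'p, 'n) functor_data =
  FOb :: "'o \<Rightarrow> 'p"
  FHom :: "'o \<Rightarrow> 'o \<Rightarrow> 'm \<Rightarrow> 'n"

text \<open>
  The object and arrow maps are required to be extensional, that is, \<open>undefined\<close> outside their
  domains, so that equality of functors is equality in HOL.
\<close>

locale is_functor = C: category C + D: category D
  for C :: "('o, 'm) cat" and D :: "('p, 'n) cat" +
  fixes F :: "('o, 'm, 'p, 'n) functor_data"
  assumes FOb_in: "FOb F \<in> Ob C \<rightarrow>\<^sub>E Ob D"
    and FHom_in:
      "\<lbrakk>a \<in> Ob C; b \<in> Ob C\<rbrakk> \<Longrightarrow> FHom F a b \<in> Hom C a b \<rightarrow>\<^sub>E Hom D (FOb F a) (FOb F b)"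
    and FHom_undefined: "a \<notin> Ob C \<or> b \<notin> Ob C \<Longrightarrow> FHom F a b = undefined"
    and FHom_Id: "a \<in> Ob C \<Longrightarrow> FHom F a a (Id C a) = Id D (FOb F a)"
    and FHom_Comp:
      "\<lbrakk>a \<in> Ob C; b \<in> Ob C; c \<in> Ob C; f \<in> Hom C a b; g \<in> Hom C b c\<rbrakk>
        \<Longrightarrow> FHom F a c (Comp C a b c g f)
          = Comp D (FOb F a) (FOb F b) (FOb F c) (FHom F b c g) (FHom F a b f)"

definition id_functor :: "('o, 'm) cat \<Rightarrow> ('o, 'm, 'o, 'm) functor_data" where
  "id_functor C = \<lparr>
     FOb = (\<lambda>a\<in>Ob C. a),
     FHom = (\<lambda>a b. if a \<in> Ob C \<and> b \<in> Ob C then (\<lambda>f\<in>Hom C a b. f) else undefined)\<rparr>"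

definition comp_functor ::
  "('o, 'm) cat \<Rightarrow> ('p, 'n, 'q, 'r) functor_data \<Rightarrow> ('o, 'm, 'p, 'n) functor_data
    \<Rightarrow> ('o, 'm, 'q, 'r) functor_data" where
  "comp_functor C G F = \<lparr>
     FOb = (\<lambda>a\<in>Ob C. FOb G (FOb F a)),
     FHom = (\<lambda>a b. if a \<in> Ob C \<and> b \<in> Ob C
       then (\<lambda>f\<in>Hom C a b. FHom G (FOb F a) (FOb F b) (FHom F a b f)) else undefined)\<rparr>"

definition full :: "('o, 'm) cat \<Rightarrow> ('p, 'n) cat \<Rightarrow> ('o, 'm, 'p, 'n) functor_data \<Rightarrow> bool" where
  "full C D F \<longleftrightarrow>
    (\<forall>a\<in>Ob C. \<forall>b\<in>Ob C. FHom F a b ` Hom C a b = Hom D (FOb F a) (FOb F b))"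

definition surj_on_objects ::
  "('o, 'm) cat \<Rightarrow> ('p, 'n) cat \<Rightarrow> ('o, 'm, 'p, 'n) functor_data \<Rightarrow> bool" where
  "surj_on_objects C D F \<longleftrightarrow> FOb F ` Ob C = Ob D"


section \<open>Extremal epimorphisms\<close>

definition monomorphism :: "('o, 'm) cat \<Rightarrow> 'o \<Rightarrow> 'o \<Rightarrow> 'm \<Rightarrow> bool" where
  "monomorphism C a b m \<longleftrightarrow> m \<in> Hom C a b \<and>
    (\<forall>x\<in>Ob C. \<forall>f\<in>Hom C x a. \<forall>g\<in>Hom C x a. Comp C x a b m f = Comp C x a b m g \<longrightarrow> f = g)"

definition epimorphism :: "('o, 'm) cat \<Rightarrow> 'o \<Rightarrow> 'o \<Rightarrow> 'm \<Rightarrow> bool" where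
  "epimorphism C a b e \<longleftrightarrow> e \<in> Hom C a b \<and>
    (\<forall>x\<in>Ob C. \<forall>f\<in>Hom C b x. \<forall>g\<in>Hom C b x. Comp C a b x f e = Comp C a b x g e \<longrightarrow> f = g)"

definition isomorphism :: "('o, 'm) cat \<Rightarrow> 'o \<Rightarrow> 'o \<Rightarrow> 'm \<Rightarrow> bool" where
  "isomorphism C a b f \<longleftrightarrow> f \<in> Hom C a b \<and>
    (\<exists>g\<in>Hom C b a. Comp C a b a g f = Id C a \<and> Comp C b a b f g = Id C b)"

definition extremal_epimorphism :: "('o, 'm) cat \<Rightarrow> 'o \<Rightarrow> 'o \<Rightarrow> 'm \<Rightarrow> bool" where
  "extremal_epimorphism C a b e \<longleftrightarrow> epimorphism C a b e \<and>
    (\<forall>x\<in>Ob C. \<forall>f\<in>Hom C a x. \<forall>m.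
      monomorphism C x b m \<and> e = Comp C a x b m f \<longrightarrow> isomorphism C x b m)"


section \<open>The category of all \<open>U\<close>-categories\<close>

definition U_category :: "('u::grothendieck_universe, 'u) cat \<Rightarrow> bool" where
  "U_category C \<longleftrightarrow> category C \<and> (\<forall>a\<in>Ob C. \<forall>b\<in>Ob C. Hom C a b \<in> range elts)"

definition Cat ::
  "(('u::grothendieck_universe, 'u) cat, ('u, 'u, 'u, 'u) functor_data) cat" where
  "Cat = \<lparr>
     Ob = Collect U_category,
     Hom = (\<lambda>C D. Collect (is_functor C D)),
     Id = id_functor,
     Comp = (\<lambda>C D E. comp_functor C)\<rparr>"

lemma category_Cat: "category Cat"
proof (unfold_locales, goal_cases)
  case (1 C)
  then interpret category C by (simp add: Cat_def U_category_def)
  show ?case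
    by (simp add: Cat_def id_functor_def, unfold_locales)
       (auto simp: Id_in_Hom Comp_in_Hom)
next
  case (2 A B C F G)
  then interpret F: is_functor A B F + G: is_functor B C G by (simp_all add: Cat_def)
  have ob: "FOb F a \<in> Ob B" if "a \<in> Ob A" for a
    using F.FOb_in that by auto
  have hom: "FHom F a b f \<in> Hom B (FOb F a) (FOb F b)"
    if "a \<in> Ob A" "b \<in> Ob A" "f \<in> Hom A a b" for a b f
    using F.FHom_in[of a b] that by auto
  have ob': "FOb G a \<in> Ob C" if "a \<in> Ob B" for a
    using G.FOb_in that by auto
  have hom': "FHom G a b f \<in> Hom C (FOb G a) (FOb G b)"
    if "a \<in> Ob B" "b \<in> Ob B" "f \<in> Hom B a b" for a b f
    using G.FHom_in[of a b] that by auto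
  show ?case
    by (simp add: Cat_def comp_functor_def, unfold_locales)
       (auto simp: F.C.Id_in_Hom F.C.Comp_in_Hom ob hom ob' hom' F.FHom_Id G.FHom_Id
          F.FHom_Comp G.FHom_Comp)
next
  case (3 A B F)
  then interpret is_functor A B F by (simp add: Cat_def)
  show ?case
    using FOb_in FHom_in FHom_undefined
    by (auto simp: Cat_def comp_functor_def id_functor_def PiE_iff extensional_def
        intro!: functor_data.equality ext)
next
  case (4 A B F)
  then interpret is_functor A B F by (simp add: Cat_def)
  show ?case
    using FOb_in FHom_in FHom_undefined
    by (auto simp: Cat_def comp_functor_def id_functor_def PiE_iff extensional_def
        intro!: functor_data.equality ext)
next
  case (5 A B C D F G H)
  then interpret F: is_functor A B F by (simp add: Cat_def)
  have ob: "FOb F a \<in> Ob B" if "a \<in> Ob A" for a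
    using F.FOb_in that by auto
  have hom: "FHom F a b f \<in> Hom B (FOb F a) (FOb F b)"
    if "a \<in> Ob A" "b \<in> Ob A" "f \<in> Hom A a b" for a b f
    using F.FHom_in[of a b] that by auto
  show ?case
    by (auto simp: Cat_def comp_functor_def ob hom intro!: ext)
qed


section \<open>Riguet fullness and Riguet congruences\<close>

definition Riguet_full :: "('o, 'm) cat \<Rightarrow> ('o, 'm, 'p, 'n) functor_data \<Rightarrow> bool" where
  "Riguet_full C F \<longleftrightarrow>
    (\<forall>a\<in>Ob C. \<forall>a'\<in>Ob C. \<forall>b\<in>Ob C. \<forall>b'\<in>Ob C. \<forall>f\<in>Hom C a b.
      FOb F a = FOb F a' \<and> FOb F b = FOb F b' \<longrightarrow>
      (\<exists>f'\<in>Hom C a' b'. FHom F a b f = FHom F a' b' f'))"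

text \<open>
  The set attached to the matrix with columns \<open>(a, a')\<close> and \<open>(b, b')\<close> is \<open>rel_fl \<Phi> (a, a') (b, b')\<close>;
  its values at pairs outside \<open>rel_ob \<Phi>\<close> are irrelevant.
\<close>

record ('o, 'm) ob_fl_relation =
  rel_ob :: "('o \<times> 'o) set"
  rel_fl :: "'o \<times> 'o \<Rightarrow> 'o \<times> 'o \<Rightarrow> ('m \<times> 'm) set"

locale Riguet_congruence = category C for C :: "('o, 'm) cat" +
  fixes \<Phi> :: "('o, 'm) ob_fl_relation"
  assumes equiv_ob: "equiv (Ob C) (rel_ob \<Phi>)"
    and fl_subset:
      "\<lbrakk>(a, a') \<in> rel_ob \<Phi>; (b, b') \<in> rel_ob \<Phi>\<rbrakk>
        \<Longrightarrow> rel_fl \<Phi> (a, a') (b, b') \<subseteq> Hom C a b \<times> Hom C a' b'"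
    and fl_Id: "(a, b) \<in> rel_ob \<Phi> \<Longrightarrow> (Id C a, Id C b) \<in> rel_fl \<Phi> (a, b) (a, b)"
    and fl_refl:
      "\<lbrakk>a \<in> Ob C; b \<in> Ob C; f \<in> Hom C a b\<rbrakk> \<Longrightarrow> (f, f) \<in> rel_fl \<Phi> (a, a) (b, b)"
    and fl_sym:
      "\<lbrakk>(a, a') \<in> rel_ob \<Phi>; (b, b') \<in> rel_ob \<Phi>; (f, f') \<in> rel_fl \<Phi> (a, a') (b, b')\<rbrakk>
        \<Longrightarrow> (f', f) \<in> rel_fl \<Phi> (a', a) (b', b)"
    and fl_trans:
      "\<lbrakk>(a, a') \<in> rel_ob \<Phi>; (b, b') \<in> rel_ob \<Phi>; (a', a'') \<in> rel_ob \<Phi>; (b', b'') \<in> rel_ob \<Phi>;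
        (f, f') \<in> rel_fl \<Phi> (a, a') (b, b'); (f', f'') \<in> rel_fl \<Phi> (a', a'') (b', b'')\<rbrakk>
        \<Longrightarrow> (f, f'') \<in> rel_fl \<Phi> (a, a'') (b, b'')"
    and fl_Comp:
      "\<lbrakk>(a, a') \<in> rel_ob \<Phi>; (b, b') \<in> rel_ob \<Phi>; (c, c') \<in> rel_ob \<Phi>;
        (f, f') \<in> rel_fl \<Phi> (a, a') (b, b'); (g, g') \<in> rel_fl \<Phi> (b, b') (c, c')\<rbrakk>
        \<Longrightarrow> (Comp C a b c g f, Comp C a' b' c' g' f') \<in> rel_fl \<Phi> (a, a') (c, c')"
    and fl_lift:
      "\<lbrakk>(a, a') \<in> rel_ob \<Phi>; (b, b') \<in> rel_ob \<Phi>; f \<in> Hom C a b\<rbrakk>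
        \<Longrightarrow> \<exists>f'\<in>Hom C a' b'. (f, f') \<in> rel_fl \<Phi> (a, a') (b, b')"

definition Riguet_kernel ::
  "('o, 'm) cat \<Rightarrow> ('o, 'm, 'p, 'n) functor_data \<Rightarrow> ('o, 'm) ob_fl_relation" where
  "Riguet_kernel C F = \<lparr>
     rel_ob = {(a, a'). a \<in> Ob C \<and> a' \<in> Ob C \<and> FOb F a = FOb F a'},
     rel_fl = (\<lambda>(a, a') (b, b').
       {(f, f'). f \<in> Hom C a b \<and> f' \<in> Hom C a' b' \<and> FHom F a b f = FHom F a' b' f'})\<rparr>"

end

theory Submission
  imports Defs
begin

text \<open>
  Throughout, the point is to understand monomorphisms of \<open>Cat\<close> and images of functors.

  A monomorphism \<open>m\<close> of \<open>Cat\<close> is injective on objects and on arrows, because the arrows of a category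
  are the functors into it from the category with two objects and one arrow between them, which
  lives in every universe (\<open>mono_Cat_injective\<close>).  If \<open>F = m \<circ> G\<close> is full and surjective on
  objects, then \<open>m\<close> is surjective on objects, hence bijective on them; so every object of its domain
  comes from \<open>C\<close> and \<open>m\<close> inherits fullness from \<open>F\<close>.  A functor that is bijective on objects and on
  hom-sets is invertible (\<open>bijective_functor_isomorphism\<close>), and \<open>F\<close> is an extremal epimorphism.

  Conversely, the arrows \<open>F f\<close> of \<open>D\<close> need not be closed under composition, since \<open>F f\<close> and \<open>F g\<close>
  may be composable without \<open>f\<close> and \<open>g\<close> being so.  Riguet-fullness repairs precisely this: \<open>g\<close> can be
  replaced by an arrow with the same image that starts where \<open>f\<close> ends (\<open>category_image_cat\<close>).
  So \<open>F\<close> factors through the subcategory of its values.  The inclusion is a monomorphism,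
  hence an isomorphism if \<open>F\<close> is extremal; then the subcategory is all of \<open>D\<close>, every object is a
  value of \<open>F\<close>, and, once more by Riguet-fullness, every arrow from \<open>F a\<close> to \<open>F b\<close> is the value of
  an arrow from \<open>a\<close> to \<open>b\<close>.

  For the Riguet kernel, all conditions on a Riguet congruence except the last hold for every
  functor, and the last one is Riguet-fullness.
\<close>

section \<open>Members of a universe\<close>

lemma singleton_in_universe: "{x} \<in> range (elts :: 'u::grothendieck_universe \<Rightarrow> 'u set)"
  using pair_in_universe[of x x] by (metis insert_absorb2 rangeI)

text \<open>A member that is minimal for membership has no elements.\<close>

lemma empty_in_universe: "{} \<in> range (elts :: 'u::grothendieck_universe \<Rightarrow> 'u set)"
proof -
  obtain z :: 'u where "\<And>y. (y, z) \<in> {(x, y). x \<in> elts y} \<Longrightarrow> y \<notin> UNIV"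
    using wfE_min[OF elts_foundation, of undefined UNIV] by blast
  then have "elts z = {}" by auto
  then show ?thesis by (metis rangeI)
qed

lemma subset_in_universe:
  fixes A B :: "'u::grothendieck_universe set"
  assumes "B \<in> range elts" "A \<subseteq> B"
  shows "A \<in> range elts"
proof -
  obtain x where x: "B = elts x" using assms(1) by blast
  obtain p where "elts ` elts p = Pow (elts x)" using power_in_universe[of x] by blast
  with x assms(2) have "A \<in> elts ` elts p" by simp
  then show ?thesis by blast
qed

text \<open>By foundation, no \<open>x\<close> equals its singleton.\<close>

lemma two_members: "\<exists>p q :: 'u::grothendieck_universe. p \<noteq> q"
proof -
  fix x :: 'u
  obtain z :: 'u where "elts z = {x, x}" using pair_in_universe by blast
  moreover have "x \<notin> elts x" using elts_foundation wf_not_refl by fastforce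
  ultimately have "z \<noteq> x" by auto
  then show ?thesis by blast
qed


section \<open>Functors\<close>

lemma (in is_functor) FOb_mem: "a \<in> Ob C \<Longrightarrow> FOb F a \<in> Ob D"
  using FOb_in by auto

lemma (in is_functor) FHom_mem:
  "\<lbrakk>a \<in> Ob C; b \<in> Ob C; f \<in> Hom C a b\<rbrakk> \<Longrightarrow> FHom F a b f \<in> Hom D (FOb F a) (FOb F b)"
  using FHom_in by blast

lemma functor_eqI:
  assumes "is_functor C D F" "is_functor C D' G"
    and "\<And>a. a \<in> Ob C \<Longrightarrow> FOb F a = FOb G a"
    and "\<And>a b f. \<lbrakk>a \<in> Ob C; b \<in> Ob C; f \<in> Hom C a b\<rbrakk> \<Longrightarrow> FHom F a b f = FHom G a b f"
  shows "F = G"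
proof -
  interpret F: is_functor C D F by fact
  interpret G: is_functor C D' G by fact
  have "FOb F = FOb G"
    using F.FOb_in G.FOb_in assms(3) by (auto simp: PiE_iff intro: extensionalityI)
  moreover have "FHom F a b = FHom G a b" for a b
  proof (cases "a \<in> Ob C \<and> b \<in> Ob C")
    case True
    then show ?thesis
      using F.FHom_in[of a b] G.FHom_in[of a b] assms(4)
      by (auto simp: PiE_iff intro: extensionalityI)
  next
    case False
    then show ?thesis using F.FHom_undefined G.FHom_undefined by metis
  qed
  ultimately show ?thesis by (auto intro!: functor_data.equality ext)
qed

lemma FOb_comp: "a \<in> Ob C \<Longrightarrow> FOb (comp_functor C G F) a = FOb G (FOb F a)"
  by (simp add: comp_functor_def)

lemma FHom_comp:
  "\<lbrakk>a \<in> Ob C; b \<in> Ob C; f \<in> Hom C a b\<rbrakk>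
    \<Longrightarrow> FHom (comp_functor C G F) a b f = FHom G (FOb F a) (FOb F b) (FHom F a b f)"
  by (simp add: comp_functor_def)

lemma is_functor_comp:
  assumes "is_functor A B F" "is_functor B C G"
  shows "is_functor A C (comp_functor A G F)"
proof -
  interpret F: is_functor A B F by fact
  interpret G: is_functor B C G by fact
  show ?thesis
    by unfold_locales
       (auto simp: comp_functor_def F.C.Id_in_Hom F.C.Comp_in_Hom F.FOb_mem F.FHom_mem G.FOb_mem
          G.FHom_mem F.FHom_Id G.FHom_Id F.FHom_Comp G.FHom_Comp)
qed

lemma is_functor_id:
  assumes "category C"
  shows "is_functor C C (id_functor C)"
proof -
  interpret category C by fact
  show ?thesis
    by unfold_locales (auto simp: id_functor_def Id_in_Hom Comp_in_Hom)
qed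

text \<open>
  Invertibility in \<open>Cat\<close> can be tested on objects and on hom-sets; preservation of identities and of
  composition by the inverse follows because \<open>m\<close> is injective on arrows.
\<close>

lemma bijective_functor_isomorphism:
  fixes X D :: "('u::grothendieck_universe, 'u) cat"
  assumes m: "is_functor X D m"
    and ob: "bij_betw (FOb m) (Ob X) (Ob D)"
    and hom: "\<And>x y. \<lbrakk>x \<in> Ob X; y \<in> Ob X\<rbrakk>
      \<Longrightarrow> bij_betw (FHom m x y) (Hom X x y) (Hom D (FOb m x) (FOb m y))"
  shows "isomorphism Cat X D m"
proof -
  interpret m: is_functor X D m by fact
  define o' where "o' = inv_into (Ob X) (FOb m)"
  define h' where "h' = (\<lambda>d e. inv_into (Hom X (o' d) (o' e)) (FHom m (o' d) (o' e)))"
  define g where "g = \<lparr>FOb = (\<lambda>d\<in>Ob D. o' d),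
    FHom = (\<lambda>d e. if d \<in> Ob D \<and> e \<in> Ob D then (\<lambda>k\<in>Hom D d e. h' d e k) else undefined)\<rparr>"
  have o'X: "o' d \<in> Ob X" and mo': "FOb m (o' d) = d" if "d \<in> Ob D" for d
    using ob that unfolding o'_def bij_betw_def by (auto intro: inv_into_into f_inv_into_f)
  have o'm: "o' (FOb m x) = x" if "x \<in> Ob X" for x
    using ob that unfolding o'_def bij_betw_def by simp
  have bij: "bij_betw (FHom m (o' d) (o' e)) (Hom X (o' d) (o' e)) (Hom D d e)"
    if "d \<in> Ob D" "e \<in> Ob D" for d e
    using hom[OF o'X o'X] mo' that by metis
  have h'X: "h' d e k \<in> Hom X (o' d) (o' e)" and mh': "FHom m (o' d) (o' e) (h' d e k) = k"
    if "d \<in> Ob D" "e \<in> Ob D" "k \<in> Hom D d e" for d e k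
    using bij[of d e] that unfolding h'_def bij_betw_def
    by (auto intro: inv_into_into f_inv_into_f)
  have h'_eqI: "h' d e k = f"
    if "d \<in> Ob D" "e \<in> Ob D" "f \<in> Hom X (o' d) (o' e)" "FHom m (o' d) (o' e) f = k" for d e k f
    using bij[of d e] that unfolding h'_def bij_betw_def by (auto intro: inv_into_f_f)
  have g: "is_functor D X g"
  proof
    show "FOb g \<in> Ob D \<rightarrow>\<^sub>E Ob X" by (auto simp: g_def o'X)
  next
    fix a b assume "a \<in> Ob D" "b \<in> Ob D"
    then show "FHom g a b \<in> Hom D a b \<rightarrow>\<^sub>E Hom X (FOb g a) (FOb g b)"
      by (auto simp: g_def h'X)
  next
    fix a b assume "a \<notin> Ob D \<or> b \<notin> Ob D"
    then show "FHom g a b = undefined" by (auto simp: g_def)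
  next
    fix a assume a: "a \<in> Ob D"
    then have "h' a a (Id D a) = Id X (o' a)"
      by (intro h'_eqI) (auto simp: m.C.Id_in_Hom m.FHom_Id o'X mo')
    with a show "FHom g a a (Id D a) = Id X (FOb g a)"
      by (simp add: g_def m.D.Id_in_Hom)
  next
    fix a b c f k
    assume *: "a \<in> Ob D" "b \<in> Ob D" "c \<in> Ob D" "f \<in> Hom D a b" "k \<in> Hom D b c"
    then have "h' a c (Comp D a b c k f) = Comp X (o' a) (o' b) (o' c) (h' b c k) (h' a b f)"
      by (intro h'_eqI) (auto simp: m.C.Comp_in_Hom m.FHom_Comp o'X mo' h'X mh')
    with * show "FHom g a c (Comp D a b c k f)
        = Comp X (FOb g a) (FOb g b) (FOb g c) (FHom g b c k) (FHom g a b f)"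
      by (simp add: g_def m.D.Comp_in_Hom)
  qed
  have "comp_functor X g m = id_functor X"
  proof (rule functor_eqI[OF is_functor_comp[OF m g] is_functor_id[OF m.C.category_axioms]])
    fix a b f assume *: "a \<in> Ob X" "b \<in> Ob X" "f \<in> Hom X a b"
    then have "h' (FOb m a) (FOb m b) (FHom m a b f) = f"
      by (intro h'_eqI) (auto simp: m.FOb_mem o'm)
    with * show "FHom (comp_functor X g m) a b f = FHom (id_functor X) a b f"
      by (simp add: FHom_comp g_def id_functor_def m.FOb_mem m.FHom_mem)
  qed (simp add: FOb_comp g_def id_functor_def m.FOb_mem o'm)
  moreover have "comp_functor D m g = id_functor D"
    by (rule functor_eqI[OF is_functor_comp[OF g m] is_functor_id[OF m.D.category_axioms]])
       (simp_all add: FOb_comp FHom_comp g_def id_functor_def mo' mh')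
  ultimately show ?thesis
    using m g by (auto simp: isomorphism_def Cat_def)
qed


section \<open>Monomorphisms of categories\<close>

text \<open>
  The category with two objects \<open>p\<close> and \<open>q\<close> and a single non-identity arrow, from \<open>p\<close> to \<open>q\<close>.
  Hom-sets may overlap, so the one value \<open>p\<close> serves as the arrow in each nonempty hom-set.
\<close>

definition arrow_cat :: "'u \<Rightarrow> 'u \<Rightarrow> ('u, 'u) cat" where
  "arrow_cat p q = \<lparr>
     Ob = {p, q},
     Hom = (\<lambda>a b. if a = q \<and> b = p then {} else {p}),
     Id = (\<lambda>_. p),
     Comp = (\<lambda>_ _ _ _ _. p)\<rparr>"

definition arrow_functor ::
  "'u \<Rightarrow> 'u \<Rightarrow> ('o, 'm) cat \<Rightarrow> 'o \<Rightarrow> 'o \<Rightarrow> 'm \<Rightarrow> ('u, 'u, 'o, 'm) functor_data" where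
  "arrow_functor p q X x y f = \<lparr>
     FOb = (\<lambda>a\<in>{p, q}. if a = p then x else y),
     FHom = (\<lambda>a b. if a \<in> {p, q} \<and> b \<in> {p, q} then
       (\<lambda>_\<in>Hom (arrow_cat p q) a b.
         if a = p then if b = p then Id X x else f else Id X y)
       else undefined)\<rparr>"

lemma category_arrow_cat: "p \<noteq> q \<Longrightarrow> category (arrow_cat p q)"
  by unfold_locales (auto simp: arrow_cat_def split: if_splits)

lemma U_category_arrow_cat:
  fixes p q :: "'u::grothendieck_universe"
  shows "p \<noteq> q \<Longrightarrow> U_category (arrow_cat p q)"
  using category_arrow_cat[of p q] singleton_in_universe[of p] empty_in_universe[where 'u = 'u]
  by (auto simp: U_category_def arrow_cat_def)

lemma is_functor_arrow_functor:
  assumes "p \<noteq> q" "category X" "x \<in> Ob X" "y \<in> Ob X" "f \<in> Hom X x y"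
  shows "is_functor (arrow_cat p q) X (arrow_functor p q X x y f)"
proof -
  interpret X: category X by fact
  interpret A: category "arrow_cat p q" using assms(1) by (rule category_arrow_cat)
  show ?thesis
    using assms
    by unfold_locales
       (auto simp: arrow_cat_def arrow_functor_def X.Id_in_Hom X.Comp_Id_left X.Comp_Id_right
         split: if_splits)
qed

text \<open>
  The functors from \<open>arrow_cat\<close> classify the arrows, and \<open>m\<close> is left-cancellable.  Taking identities
  for \<open>f\<close> and \<open>f'\<close> gives injectivity on objects.
\<close>

lemma mono_Cat_injective:
  fixes X D :: "('u::grothendieck_universe, 'u) cat"
  assumes mono: "monomorphism Cat X D m"
    and f: "x \<in> Ob X" "y \<in> Ob X" "f \<in> Hom X x y"
    and f': "x' \<in> Ob X" "y' \<in> Ob X" "f' \<in> Hom X x' y'"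
    and eq: "FOb m x = FOb m x'" "FOb m y = FOb m y'" "FHom m x y f = FHom m x' y' f'"
  shows "x = x'" "y = y'" "f = f'"
proof -
  obtain p q :: 'u where pq: "p \<noteq> q" using two_members by blast
  from mono interpret m: is_functor X D m by (simp add: monomorphism_def Cat_def)
  let ?A = "arrow_cat p q"
  let ?G = "arrow_functor p q X x y f" and ?G' = "arrow_functor p q X x' y' f'"
  have G: "is_functor ?A X ?G" and G': "is_functor ?A X ?G'"
    using is_functor_arrow_functor[OF pq m.C.category_axioms] f f' by blast+
  have "comp_functor ?A m ?G = comp_functor ?A m ?G'"
    by (rule functor_eqI[OF is_functor_comp[OF G m.is_functor_axioms]
            is_functor_comp[OF G' m.is_functor_axioms]])
       (use pq f f' eq in \<open>auto simp: FOb_comp FHom_comp arrow_functor_def arrow_cat_def m.FHom_Id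
         split: if_splits\<close>)
  with mono G G' U_category_arrow_cat[OF pq] have "?G = ?G'"
    by (auto simp: monomorphism_def Cat_def)
  then have "FOb ?G p = FOb ?G' p" "FOb ?G q = FOb ?G' q" "FHom ?G p q p = FHom ?G' p q p"
    by simp_all
  with pq show "x = x'" "y = y'" "f = f'"
    by (simp_all add: arrow_functor_def arrow_cat_def)
qed


section \<open>Full functors that are surjective on objects\<close>

lemma full_surj_epimorphism:
  assumes F: "is_functor C D F" and full: "full C D F" and surj: "surj_on_objects C D F"
  shows "epimorphism Cat C D F"
proof -
  interpret F: is_functor C D F by fact
  have "G = H"
    if G: "is_functor D E G" and H: "is_functor D E H"
      and eq: "comp_functor C G F = comp_functor C H F" for E G H
  proof (rule functor_eqI[OF G H])
    fix d assume "d \<in> Ob D"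
    then obtain a where "a \<in> Ob C" "d = FOb F a" using surj by (auto simp: surj_on_objects_def)
    then show "FOb G d = FOb H d" using eq by (metis FOb_comp)
  next
    fix d e k assume "d \<in> Ob D" "e \<in> Ob D" and k: "k \<in> Hom D d e"
    then obtain a b where ab: "a \<in> Ob C" "d = FOb F a" "b \<in> Ob C" "e = FOb F b"
      using surj unfolding surj_on_objects_def by (metis imageE)
    then obtain f where "f \<in> Hom C a b" "k = FHom F a b f"
      using full k unfolding full_def by (metis imageE)
    then show "FHom G d e k = FHom H d e k" using eq ab by (metis FHom_comp)
  qed
  with F show ?thesis by (auto simp: epimorphism_def Cat_def)
qed

lemma full_surj_extremal_epimorphism:
  fixes C D :: "('u::grothendieck_universe, 'u) cat"
  assumes F: "is_functor C D F" and full: "full C D F" and surj: "surj_on_objects C D F"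
  shows "extremal_epimorphism Cat C D F"
proof -
  have "isomorphism Cat X D m"
    if G: "is_functor C X G" and mono: "monomorphism Cat X D m"
      and eq: "F = comp_functor C m G" for X G m
  proof -
    interpret G: is_functor C X G by fact
    from mono have m: "is_functor X D m" by (simp add: monomorphism_def Cat_def)
    interpret m: is_functor X D m by fact
    have obj_inj: "x = x'" if "x \<in> Ob X" "x' \<in> Ob X" "FOb m x = FOb m x'" for x x'
      by (rule mono_Cat_injective(1)[OF mono, of x x "Id X x" x' x' "Id X x'"])
         (use that in \<open>auto simp: G.D.Id_in_Hom m.FHom_Id\<close>)
    have FOb_eq: "FOb F a = FOb m (FOb G a)" if "a \<in> Ob C" for a
      using that by (simp add: eq FOb_comp)
    have ob: "bij_betw (FOb m) (Ob X) (Ob D)"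
      unfolding bij_betw_def
    proof
      show "inj_on (FOb m) (Ob X)" using obj_inj by (auto intro: inj_onI)
      show "FOb m ` Ob X = Ob D"
        using surj FOb_eq G.FOb_mem m.FOb_mem unfolding surj_on_objects_def by force
    qed
    have lift: "\<exists>a\<in>Ob C. x = FOb G a" if x: "x \<in> Ob X" for x
    proof -
      obtain a where "a \<in> Ob C" "FOb m x = FOb F a"
        using surj m.FOb_mem[OF x] unfolding surj_on_objects_def by (metis imageE)
      then show ?thesis using obj_inj[OF x G.FOb_mem] FOb_eq by metis
    qed
    have "bij_betw (FHom m x y) (Hom X x y) (Hom D (FOb m x) (FOb m y))"
      if x: "x \<in> Ob X" and y: "y \<in> Ob X" for x y
      unfolding bij_betw_def
    proof (intro conjI equalityI subsetI)
      show "inj_on (FHom m x y) (Hom X x y)"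
        by (rule inj_onI, rule mono_Cat_injective(3)[OF mono x y _ x y]) auto
    next
      fix k assume "k \<in> FHom m x y ` Hom X x y"
      then show "k \<in> Hom D (FOb m x) (FOb m y)" using m.FHom_mem x y by blast
    next
      fix k assume k: "k \<in> Hom D (FOb m x) (FOb m y)"
      obtain a b where ab: "a \<in> Ob C" "x = FOb G a" "b \<in> Ob C" "y = FOb G b"
        using lift x y by blast
      then have "k \<in> FHom F a b ` Hom C a b"
        using full k FOb_eq by (simp add: full_def)
      then obtain f where f: "f \<in> Hom C a b" "k = FHom F a b f" by blast
      then have "k = FHom m x y (FHom G a b f)"
        using ab by (simp add: eq FHom_comp)
      then show "k \<in> FHom m x y ` Hom X x y" using ab f G.FHom_mem by blast
    qed
    with m ob show ?thesis by (rule bijective_functor_isomorphism)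
  qed
  with full_surj_epimorphism[OF assms] show ?thesis
    by (auto simp: extremal_epimorphism_def Cat_def)
qed

lemma full_imp_Riguet_full:
  assumes F: "is_functor C D F" and full: "full C D F"
  shows "Riguet_full C F"
  unfolding Riguet_full_def
proof (intro ballI impI)
  interpret F: is_functor C D F by fact
  fix a a' b b' f
  assume *: "a \<in> Ob C" "a' \<in> Ob C" "b \<in> Ob C" "b' \<in> Ob C" "f \<in> Hom C a b"
    "FOb F a = FOb F a' \<and> FOb F b = FOb F b'"
  then have "FHom F a b f \<in> Hom D (FOb F a') (FOb F b')" using F.FHom_mem by metis
  also have "\<dots> = FHom F a' b' ` Hom C a' b'" using full * by (simp add: full_def)
  finally show "\<exists>f'\<in>Hom C a' b'. FHom F a b f = FHom F a' b' f'" by blast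
qed


section \<open>Images of Riguet-full functors\<close>

definition image_cat ::
  "('o, 'm) cat \<Rightarrow> ('p, 'n) cat \<Rightarrow> ('o, 'm, 'p, 'n) functor_data \<Rightarrow> ('p, 'n) cat" where
  "image_cat C D F = \<lparr>
     Ob = FOb F ` Ob C,
     Hom = (\<lambda>x y. {FHom F a b f | a b f.
       a \<in> Ob C \<and> b \<in> Ob C \<and> f \<in> Hom C a b \<and> FOb F a = x \<and> FOb F b = y}),
     Id = Id D,
     Comp = Comp D\<rparr>"

lemma image_cat_simps [simp]:
  "Ob (image_cat C D F) = FOb F ` Ob C"
  "Id (image_cat C D F) = Id D"
  "Comp (image_cat C D F) = Comp D"
  by (simp_all add: image_cat_def)

text \<open>
  Riguet-fullness lets the objects over the endpoints be chosen freely, so that composable arrows of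
  the image come from composable arrows.
\<close>

lemma image_cat_Hom_lift:
  assumes "Riguet_full C F" "a \<in> Ob C" "b \<in> Ob C"
  shows "Hom (image_cat C D F) (FOb F a) (FOb F b) = FHom F a b ` Hom C a b"
  using assms unfolding image_cat_def Riguet_full_def by (auto, metis imageI)

lemma image_cat_Hom_subset:
  assumes "is_functor C D F"
  shows "Hom (image_cat C D F) x y \<subseteq> Hom D x y"
proof -
  interpret F: is_functor C D F by fact
  show ?thesis using F.FHom_mem by (auto simp: image_cat_def)
qed

lemma category_image_cat:
  assumes F: "is_functor C D F" and R: "Riguet_full C F"
  shows "category (image_cat C D F)"
proof -
  interpret F: is_functor C D F by fact
  let ?I = "image_cat C D F"
  note sub = subsetD[OF image_cat_Hom_subset[OF F]]
  note lift = image_cat_Hom_lift[OF R]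
  show ?thesis
  proof
    fix x assume "x \<in> Ob ?I"
    then obtain a where a: "a \<in> Ob C" "x = FOb F a" by auto
    then have "Id D x = FHom F a a (Id C a)" by (simp add: F.FHom_Id)
    with a show "Id ?I x \<in> Hom ?I x x" by (simp add: lift F.C.Id_in_Hom)
  next
    fix x y z k l
    assume "x \<in> Ob ?I" "y \<in> Ob ?I" "z \<in> Ob ?I" and kl: "k \<in> Hom ?I x y" "l \<in> Hom ?I y z"
    then obtain a b c where abc: "a \<in> Ob C" "x = FOb F a" "b \<in> Ob C" "y = FOb F b"
      "c \<in> Ob C" "z = FOb F c" by auto
    with kl obtain f g where fg: "f \<in> Hom C a b" "k = FHom F a b f"
      "g \<in> Hom C b c" "l = FHom F b c g" by (auto simp: lift)
    with abc have "Comp D x y z l k = FHom F a c (Comp C a b c g f)"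
      by (simp add: F.FHom_Comp)
    with abc fg show "Comp ?I x y z l k \<in> Hom ?I x z"
      by (simp add: lift F.C.Comp_in_Hom)
  next
    fix x y k assume "x \<in> Ob ?I" "y \<in> Ob ?I" "k \<in> Hom ?I x y"
    then show "Comp ?I x x y k (Id ?I x) = k"
      using F.FOb_mem sub by (auto intro!: F.D.Comp_Id_right)
  next
    fix x y k assume "x \<in> Ob ?I" "y \<in> Ob ?I" "k \<in> Hom ?I x y"
    then show "Comp ?I x y y (Id ?I y) k = k"
      using F.FOb_mem sub by (auto intro!: F.D.Comp_Id_left)
  next
    fix w x y z k l n
    assume "w \<in> Ob ?I" "x \<in> Ob ?I" "y \<in> Ob ?I" "z \<in> Ob ?I"
      "k \<in> Hom ?I w x" "l \<in> Hom ?I x y" "n \<in> Hom ?I y z"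
    then show "Comp ?I w y z n (Comp ?I w x y l k) = Comp ?I w x z (Comp ?I x y z n l) k"
      using F.FOb_mem sub by (auto intro!: F.D.Comp_assoc)
  qed
qed

text \<open>
  Functor data do not record the codomain: the corestriction of \<open>F\<close> to its image is \<open>F\<close> itself, and
  the inclusion of the image is its \<open>id_functor\<close>.
\<close>

lemma is_functor_corestriction:
  assumes F: "is_functor C D F" and R: "Riguet_full C F"
  shows "is_functor C (image_cat C D F) F"
proof -
  interpret F: is_functor C D F by fact
  interpret I: category "image_cat C D F" using assms by (rule category_image_cat)
  show ?thesis
  proof
    show "FOb F \<in> Ob C \<rightarrow>\<^sub>E Ob (image_cat C D F)" using F.FOb_in by (auto simp: PiE_iff)
  next
    fix a b assume "a \<in> Ob C" "b \<in> Ob C"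
    then show "FHom F a b \<in> Hom C a b \<rightarrow>\<^sub>E Hom (image_cat C D F) (FOb F a) (FOb F b)"
      using F.FHom_in[of a b] by (auto simp: image_cat_Hom_lift[OF R] PiE_iff)
  qed (simp_all add: F.FHom_undefined F.FHom_Id F.FHom_Comp)
qed

lemma is_functor_inclusion:
  assumes F: "is_functor C D F" and R: "Riguet_full C F"
  shows "is_functor (image_cat C D F) D (id_functor (image_cat C D F))"
proof -
  interpret F: is_functor C D F by fact
  interpret I: category "image_cat C D F" using assms by (rule category_image_cat)
  show ?thesis
    using subsetD[OF image_cat_Hom_subset[OF F]] I.Id_in_Hom I.Comp_in_Hom
    by unfold_locales (auto simp: id_functor_def F.FOb_mem)
qed

lemma comp_id_functor:
  assumes "is_functor C X G"
  shows "comp_functor C (id_functor X) G = G"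
proof -
  interpret G: is_functor C X G by fact
  show ?thesis
    by (rule functor_eqI[OF is_functor_comp[OF assms is_functor_id[OF G.D.category_axioms]] assms])
       (simp_all add: FOb_comp FHom_comp id_functor_def G.FOb_mem G.FHom_mem)
qed

lemma monomorphism_inclusion:
  assumes "is_functor X D (id_functor X)"
  shows "monomorphism Cat X D (id_functor X)"
  using assms by (auto simp: monomorphism_def Cat_def comp_id_functor)

lemma U_category_image_cat:
  assumes "U_category D" "is_functor C D F" "Riguet_full C F"
  shows "U_category (image_cat C D F)"
proof -
  interpret F: is_functor C D F by fact
  show ?thesis
    using assms category_image_cat[OF assms(2,3)] F.FOb_mem
      subset_in_universe[OF _ image_cat_Hom_subset[OF assms(2)]]
    by (auto simp: U_category_def)
qed

lemma extremal_Riguet_full_imp_full_surj: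
  assumes D: "U_category D" and F: "is_functor C D F"
    and ext: "extremal_epimorphism Cat C D F" and R: "Riguet_full C F"
  shows "full C D F" "surj_on_objects C D F"
proof -
  interpret F: is_functor C D F by fact
  let ?I = "image_cat C D F"
  let ?m = "id_functor ?I"
  have corestr: "is_functor C ?I F" using F R by (rule is_functor_corestriction)
  have "isomorphism Cat ?I D ?m"
    using ext U_category_image_cat[OF D F R] corestr comp_id_functor[OF corestr]
      monomorphism_inclusion[OF is_functor_inclusion[OF F R]]
    by (simp add: extremal_epimorphism_def Cat_def)
  then obtain g where g: "is_functor D ?I g" and mg: "comp_functor D ?m g = id_functor D"
    by (auto simp: isomorphism_def Cat_def)
  (* A section of an inclusion is the identity map, so everything in D lies in the image. *)
  have "g = id_functor D" using mg comp_id_functor[OF g] by simp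
  with g interpret g: is_functor D ?I "id_functor D" by simp
  have ob: "d \<in> FOb F ` Ob C" if "d \<in> Ob D" for d
    using g.FOb_mem[OF that] that by (simp add: id_functor_def)
  have hom: "k \<in> Hom ?I d e" if "d \<in> Ob D" "e \<in> Ob D" "k \<in> Hom D d e" for d e k
    using g.FHom_mem[OF that] that by (simp add: id_functor_def)
  show "surj_on_objects C D F"
    using ob F.FOb_mem by (auto simp: surj_on_objects_def)
  have "FHom F a b ` Hom C a b = Hom D (FOb F a) (FOb F b)" if "a \<in> Ob C" "b \<in> Ob C" for a b
    using hom[OF F.FOb_mem[OF that(1)] F.FOb_mem[OF that(2)]] image_cat_Hom_subset[OF F]
      image_cat_Hom_lift[OF R that] by blast
  then show "full C D F" by (simp add: full_def)
qed


section \<open>The Riguet kernel\<close>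

lemma Riguet_full_iff_Riguet_congruence:
  assumes F: "is_functor C D F"
  shows "Riguet_full C F \<longleftrightarrow> Riguet_congruence C (Riguet_kernel C F)"
proof
  interpret F: is_functor C D F by fact
  assume R: "Riguet_full C F"
  show "Riguet_congruence C (Riguet_kernel C F)"
  proof
    show "equiv (Ob C) (rel_ob (Riguet_kernel C F))"
      by (auto simp: Riguet_kernel_def equiv_def refl_on_def sym_def trans_def)
  next
    fix a a' b b' f
    assume "(a, a') \<in> rel_ob (Riguet_kernel C F)" "(b, b') \<in> rel_ob (Riguet_kernel C F)"
      "f \<in> Hom C a b"
    then show "\<exists>f'\<in>Hom C a' b'. (f, f') \<in> rel_fl (Riguet_kernel C F) (a, a') (b, b')"
      using R by (fastforce simp: Riguet_kernel_def Riguet_full_def)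
  qed (auto simp: Riguet_kernel_def F.C.Id_in_Hom F.C.Comp_in_Hom F.FHom_Id F.FHom_Comp)
next
  assume "Riguet_congruence C (Riguet_kernel C F)"
  then interpret K: Riguet_congruence C "Riguet_kernel C F" .
  show "Riguet_full C F"
    unfolding Riguet_full_def using K.fl_lift by (auto simp: Riguet_kernel_def)
qed

theorem proposition2p18:
  fixes C D :: "('u::grothendieck_universe, 'u) cat"
    and F :: "('u, 'u, 'u, 'u) functor_data"
  assumes "C \<in> Ob Cat" and "D \<in> Ob Cat" and "F \<in> Hom Cat C D"
  shows "(full C D F \<and> surj_on_objects C D F
            \<longleftrightarrow> extremal_epimorphism Cat C D F \<and> Riguet_full C F)
       \<and> (Riguet_full C F \<longleftrightarrow> Riguet_congruence C (Riguet_kernel C F))"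
proof -
  have D: "U_category D" and F: "is_functor C D F" using assms by (simp_all add: Cat_def)
  show ?thesis
    using full_surj_extremal_epimorphism[OF F] full_imp_Riguet_full[OF F]
      extremal_Riguet_full_imp_full_surj[OF D F] Riguet_full_iff_Riguet_congruence[OF F]
    by blast
qed

end
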